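(* Let $A\subset\mathbb{R}^2$ be a domain whose boundary $\partial A$ is a rectifiable curve, let $\varepsilon$ be a real number, and assume that $$|\partial A|^2\leqslant (16+\varepsilon)\,|A|.$$ Then there is a square $S$ such that $$d_\infty(A,S)^2\leqslant\frac{\varepsilon\, |A|}{64}.$$
   Context: The plane $\mathbb{R}^2$ is endowed with the $L^1$ metric $|(x_1,x_2)-(y_1,y_2)|=|x_1-y_1|+|x_2-y_2|$. A *domain* is the closure of the bounded connected component of the complement of a Jordan curve in $\mathbb{R}^2$; $\partial A$ denotes the boundary of $A$. For a measurable set $A$, $|A|$ is its Lebesgue measure; for a rectifiable curve $\gamma$, $|\gamma|$ is its length with respect to the $L^1$ metric; in particular $|\partial A|$ is the $L^1$ length of the Jordan curve $\partial A$. All squares (taken as full closed squares) have their sides parallel to the coordinate axes. For $\lambda\geqslant 0$, $B_\infty(\lambda)=[-\lambda,\lambda]^2$. For compact sets $A,B\subset\mathbb{R}^2$, $d_\infty(A,B)=\inf\{\lambda\geqslant 0 : A\subset B+B_\infty(\lambda)\text{ and }B\subset A+B_\infty(\lambda)\}$ (Minkowski sums), i.e. the Hausdorff distance for the $L^\infty$ metric. *)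

theory Defs
  imports "HOL-Analysis.Analysis"
begin

type_synonym plane = "real \<times> real"

definition L1_dist :: "plane \<Rightarrow> plane \<Rightarrow> real" where
  "L1_dist x y = \<bar>fst x - fst y\<bar> + \<bar>snd x - snd y\<bar>"

definition Jordan_curve :: "(real \<Rightarrow> plane) \<Rightarrow> bool" where
  "Jordan_curve g \<longleftrightarrow> simple_path g \<and> pathfinish g = pathstart g"

definition domain :: "plane set \<Rightarrow> bool" where
  "domain A \<longleftrightarrow>
     (\<exists>g C. Jordan_curve g \<and> C \<in> components (- path_image g) \<and> bounded C \<and> A = closure C)"

(* The L1 lengths of the polygons inscribed in g, over the subdivisions
   0 = t 0 \<le> t 1 \<le> ... \<le> t n = 1 of the parameter interval. *)
definition inscribed_lengths :: "(real \<Rightarrow> plane) \<Rightarrow> real set" where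
  "inscribed_lengths g =
     {(\<Sum>i<n. L1_dist (g (t i)) (g (t (Suc i)))) | (n :: nat) (t :: nat \<Rightarrow> real).
        t 0 = 0 \<and> t n = 1 \<and> mono_on {..n} t}"

definition rectifiable :: "(real \<Rightarrow> plane) \<Rightarrow> bool" where
  "rectifiable g \<longleftrightarrow> bdd_above (inscribed_lengths g)"

(* Only meaningful for rectifiable g: Sup of an unbounded set of reals is unspecified. *)
definition L1_length :: "(real \<Rightarrow> plane) \<Rightarrow> real" where
  "L1_length g = Sup (inscribed_lengths g)"

definition is_square :: "plane set \<Rightarrow> bool" where
  "is_square S \<longleftrightarrow> (\<exists>a b l. l > 0 \<and> S = {a..a + l} \<times> {b..b + l})"

definition B_inf :: "real \<Rightarrow> plane set" where
  "B_inf r = {-r..r} \<times> {-r..r}"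

(* The sums of sets are Minkowski sums (HOL-Library.Set_Algebras). For nonempty bounded A and B
   the set of admissible r is nonempty, so the infimum is the mathematical one. *)
definition d_inf :: "plane set \<Rightarrow> plane set \<Rightarrow> real" where
  "d_inf A B = Inf {r. r \<ge> 0 \<and> A \<subseteq> B + B_inf r \<and> B \<subseteq> A + B_inf r}"

end

theory Submission
  imports Defs
begin

text \<open>
  Let $w$ and $v$ be the width and the height of the bounding box of \<open>A\<close>. A closed
  curve that meets all four sides of the box crosses it twice in each direction, so $|\partial A|
  \geq 2(w+v)$ (\<open>L1_length_ge_widths\<close>). Hence it suffices to find, for every compact
  connected set \<open>A\<close> of positive area, a square at distance at most \<open>d\<close>,
  where $(2d)^2 = ((w+v)/2)^2 - |A|$ (\<open>near_square\<close>). By reflection in the diagonal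
  assume $v \leq w$.
\<close>

text \<open>
  Put $h = (w-v)/2$ and let $\mu = wv - |A|$ be the area of the box not covered by \<open>A\<close>;
  then $(2d)^2 = h^2 + \mu$. Shrink the horizontal side of the box by \<open>d\<close> at both ends
  and take a square \<open>S\<close> of this width $w - 2d$. Enlarged by \<open>d\<close>, it is a
  square of side \<open>w\<close> which contains the box as long as it protrudes below by some $u
  \in [0,2h]$ and above by $2h-u$. So the inclusion of \<open>A\<close> in the enlarged square holds
  for every such \<open>u\<close>, and \<open>u\<close> is still to be chosen.
\<close>

text \<open>
  The other inclusion fails only if slightly more than the square of side $2d$ around some point of
  \<open>S\<close> misses \<open>A\<close>. If that square lies in the box, this forces $\mu >
  (2d)^2$, which is impossible (\<open>missing_square_area\<close>). If it protrudes on both sides,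
  it cuts the connected set \<open>A\<close> in two. If it protrudes below, it leaves a bay of
  \<open>A\<close> of width $2d$ that starts on the lower side and is deeper than $2d-u$; if above,
  there is a bay on the upper side deeper than $2d-(2h-u)$. Since \<open>A\<close> is connected, a
  lower and an upper bay of width $2d$ never overlap (\<open>bays_do_not_overlap\<close>), so the
  largest depths $\beta$ and $\tau$ satisfy $2d(\beta+\tau) \leq \mu = (2d)^2 - h^2$. As $(2d-h)^2
  \geq 0$, this gives $\beta + \tau \leq 4d - 2h$. Together with $\beta, \tau \leq 2d$ this is what
  is needed for some \<open>u\<close> to exclude both kinds of bays
  (\<open>ex_vertical_offset\<close>).
\<close>

section \<open>The Hausdorff distance for the maximum metric\<close>

lemma subset_plus_B_inf_iff:
  "A \<subseteq> S + B_inf r \<longleftrightarrow>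
     (\<forall>p\<in>A. \<exists>q\<in>S. \<bar>fst p - fst q\<bar> \<le> r \<and> \<bar>snd p - snd q\<bar> \<le> r)"
proof -
  have "p \<in> S + B_inf r \<longleftrightarrow> (\<exists>q\<in>S. \<bar>fst p - fst q\<bar> \<le> r \<and> \<bar>snd p - snd q\<bar> \<le> r)" for p
  proof
    assume "p \<in> S + B_inf r"
    then obtain q e where "q \<in> S" "e \<in> B_inf r" "p = q + e"
      by (auto elim: set_plus_elim)
    then show "\<exists>q\<in>S. \<bar>fst p - fst q\<bar> \<le> r \<and> \<bar>snd p - snd q\<bar> \<le> r"
      by (intro bexI[of _ q]) (auto simp: B_inf_def)
  next
    assume "\<exists>q\<in>S. \<bar>fst p - fst q\<bar> \<le> r \<and> \<bar>snd p - snd q\<bar> \<le> r"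
    then obtain q where q: "q \<in> S" "\<bar>fst p - fst q\<bar> \<le> r" "\<bar>snd p - snd q\<bar> \<le> r"
      by blast
    then have "p - q \<in> B_inf r"
      by (cases p; cases q) (auto simp: B_inf_def)
    then have "q + (p - q) \<in> S + B_inf r"
      using q(1) by (rule set_plus_intro[rotated])
    then show "p \<in> S + B_inf r" by simp
  qed
  then show ?thesis by blast
qed

lemma d_inf_swap: "d_inf (prod.swap ` A) (prod.swap ` S) = d_inf A S"
proof -
  have "prod.swap ` X \<subseteq> prod.swap ` Y + B_inf r \<longleftrightarrow> X \<subseteq> Y + B_inf r" for X Y :: "plane set" and r
    by (simp add: subset_plus_B_inf_iff conj_commute)
  then show ?thesis by (simp add: d_inf_def)
qed

text \<open>
  The infimum allows the slack $\eta$. Thanks to it, a point of one set that is too far from the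
  other has a whole neighbourhood that misses the other set, which makes the area estimates below
  strict.
\<close>

lemma d_inf_le:
  assumes "0 \<le> d"
    and "\<And>\<eta>. \<eta> > 0 \<Longrightarrow> A \<subseteq> S + B_inf (d + \<eta>) \<and> S \<subseteq> A + B_inf (d + \<eta>)"
  shows "d_inf A S \<le> d"
proof (rule field_le_epsilon)
  fix \<eta> :: real assume "\<eta> > 0"
  then show "d_inf A S \<le> d + \<eta>"
    unfolding d_inf_def using assms by (intro cInf_lower) (auto intro: bdd_belowI[of _ 0])
qed

text \<open>
  An infimum of nonnegative reals is nonnegative only if there are any: the diameter of the union of
  the two sets is an admissible radius.
\<close>

lemma d_inf_nonneg:
  assumes "bounded A" "bounded S" "A \<noteq> {}" "S \<noteq> {}"
  shows "0 \<le> d_inf A S"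
proof -
  obtain e where e: "\<And>x y. x \<in> A \<union> S \<Longrightarrow> y \<in> A \<union> S \<Longrightarrow> dist x y \<le> e"
    using assms(1,2) by (metis bounded_Un bounded_two_points)
  have coords: "\<bar>fst x - fst y\<bar> \<le> e" "\<bar>snd x - snd y\<bar> \<le> e" if "x \<in> A \<union> S" "y \<in> A \<union> S" for x y
    using e[OF that] dist_fst_le[of x y] dist_snd_le[of x y] by (auto simp: dist_real_def)
  obtain x where "x \<in> A" using assms(3) by blast
  then have "e \<ge> 0" using e[of x x] by simp
  moreover have "A \<subseteq> S + B_inf e" "S \<subseteq> A + B_inf e"
    using coords assms(3,4) unfolding subset_plus_B_inf_iff by blast+
  ultimately show ?thesis
    unfolding d_inf_def by (intro cInf_greatest) auto
qed

section \<open>Compact connected sets in their bounding box\<close>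

lemma box_Pair: "box (x1, y1) (x2, y2) = {x1<..<x2} \<times> {y1<..<y2::real}" for x1 x2 :: real
  by (auto simp: box_def Basis_prod_def)

lemma measure_open_rectangle:
  fixes x1 x2 y1 y2 :: real
  assumes "x1 \<le> x2" "y1 \<le> y2"
  shows "measure lebesgue (box (x1, y1) (x2, y2)) = (x2 - x1) * (y2 - y1)"
  using assms by (simp add: measure_lborel_box_eq Basis_prod_def inner_prod_def ball_Un image_Un
      prod.union_disjoint prod.reindex inj_on_def)

locale boxed_continuum =
  fixes A :: "plane set" and l r b t :: real
  assumes compact: "compact A"
    and connected: "connected A"
    and in_box: "A \<subseteq> {l..r} \<times> {b..t}"
    and touch: "\<exists>y. (l, y) \<in> A" "\<exists>y. (r, y) \<in> A" "\<exists>x. (x, b) \<in> A" "\<exists>x. (x, t) \<in> A"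
begin

lemma box_ordered: "l \<le> r" "b \<le> t"
  using touch in_box by fastforce+

lemma A_lmeasurable: "A \<in> lmeasurable"
  using compact by (rule lmeasurable_compact)

lemma missing_area:
  assumes "R \<in> lmeasurable" "R \<subseteq> {l..r} \<times> {b..t}" "R \<inter> A = {}"
  shows "measure lebesgue R \<le> (r - l) * (t - b) - measure lebesgue A"
proof -
  have "measure lebesgue ({l..r} \<times> {b..t}) = (r - l) * (t - b)"
    using box_ordered content_Pair[of l b r t]
    by (simp add: cbox_Pair_eq borel_closed closed_Times)
  moreover have "{l..r} \<times> {b..t} \<in> lmeasurable"
    by (metis cbox_Pair_eq cbox_interval lmeasurable_cbox)
  moreover have "measure lebesgue (R \<union> A) = measure lebesgue R + measure lebesgue A"
    using assms A_lmeasurable by (intro measure_Un2[THEN trans]) (auto simp: Diff_triv Int_commute)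
  ultimately show ?thesis
    using measure_mono_fmeasurable[of "R \<union> A" "{l..r} \<times> {b..t}" lebesgue] assms in_box A_lmeasurable
    by (auto simp: fmeasurableD)
qed

lemma area_le: "measure lebesgue A \<le> (r - l) * (t - b)"
  using missing_area[of "{}"] by simp

text \<open>
  The form in which connectedness enters: \<open>A\<close> has points on the left and on the right
  side of the box, and these cannot be separated by open sets.
\<close>

lemma no_separation:
  assumes "open U" "open V" "A \<subseteq> U \<union> V" "U \<inter> V = {}"
    and "\<And>y. (l, y) \<notin> V" "\<And>y. (r, y) \<notin> U"
  shows False
proof -
  from touch obtain y y' where "(l, y) \<in> A" "(r, y') \<in> A" by blast
  with assms connectedD[OF connected, of U V] show False by blast
qed

lemma no_crossing_strip:
  assumes "l \<le> x" "x \<le> x'" "x' \<le> r"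
    and "\<And>p. p \<in> A \<Longrightarrow> \<not> (x \<le> fst p \<and> fst p \<le> x')"
  shows False
proof (rule no_separation)
  show "open {p::plane. fst p < x}" "open {p::plane. x' < fst p}"
    by (intro open_Collect_less continuous_intros)+
qed (use assms in force)+

section \<open>Bays\<close>

text \<open>
  A bay is a rectangle of width \<open>s\<close> and depth \<open>k\<close> that stands on one
  horizontal side of the box and misses \<open>A\<close>. The inner horizontal edge is left out, so
  that a bay of depth \<open>0\<close> exists at every position and the set of depths is never
  empty.
\<close>

definition bottom_bay :: "real \<Rightarrow> real \<Rightarrow> real \<Rightarrow> bool" where
  "bottom_bay s x k \<longleftrightarrow> 0 \<le> k \<and> k \<le> t - b \<and> l \<le> x \<and> x + s \<le> r \<and>
     (\<forall>p\<in>A. \<not> (x \<le> fst p \<and> fst p \<le> x + s \<and> snd p < b + k))"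

definition top_bay :: "real \<Rightarrow> real \<Rightarrow> real \<Rightarrow> bool" where
  "top_bay s x k \<longleftrightarrow> 0 \<le> k \<and> k \<le> t - b \<and> l \<le> x \<and> x + s \<le> r \<and>
     (\<forall>p\<in>A. \<not> (x \<le> fst p \<and> fst p \<le> x + s \<and> t - k < snd p))"

text \<open>
  If the bays overlapped, their union would reach from the bottom of the box to the top. The rest of
  the box would then fall into two disjoint open regions that separate \<open>A\<close>: the left
  one consists of the points to the left of both bays, and of those to the left of the bay further
  right that are beyond the depth of the bay further left; the right one is described in the same
  way.
\<close>

lemma bays_do_not_overlap:
  assumes "0 \<le> s" "bottom_bay s x k" "top_bay s x' m"
  shows "k + m \<le> t - b \<or> x + s < x' \<or> x' + s < x"
proof (rule ccontr)
  assume "\<not> ?thesis"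
  then have tall: "k + m > t - b" and ov: "x' \<le> x + s" "x \<le> x' + s" by auto
  note bay = assms(2,3)[unfolded bottom_bay_def top_bay_def]
  show False
  proof (cases "x \<le> x'")
    case True
    show False
    proof (rule no_separation)
      show "open ({p::plane. fst p < x} \<union> {p. fst p < x'} \<inter> {p. t - m < snd p})"
        "open ({p::plane. x' + s < fst p} \<union> {p. x + s < fst p} \<inter> {p. snd p < b + k})"
        by (intro open_Un open_Int open_Collect_less continuous_intros)+
      show "A \<subseteq> ({p. fst p < x} \<union> {p. fst p < x'} \<inter> {p. t - m < snd p}) \<union>
         ({p. x' + s < fst p} \<union> {p. x + s < fst p} \<inter> {p. snd p < b + k})"
      proof
        fix p assume "p \<in> A"
        then have "\<not> (x \<le> fst p \<and> fst p \<le> x + s \<and> snd p < b + k)"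
          "\<not> (x' \<le> fst p \<and> fst p \<le> x' + s \<and> t - m < snd p)" using bay by blast+
        then show "p \<in> ({p. fst p < x} \<union> {p. fst p < x'} \<inter> {p. t - m < snd p}) \<union>
         ({p. x' + s < fst p} \<union> {p. x + s < fst p} \<inter> {p. snd p < b + k})"
          using tall ov by auto
      qed
    qed (use bay True tall ov assms(1) in auto)
  next
    case False
    show False
    proof (rule no_separation)
      show "open ({p::plane. fst p < x'} \<union> {p. fst p < x} \<inter> {p. snd p < b + k})"
        "open ({p::plane. x + s < fst p} \<union> {p. x' + s < fst p} \<inter> {p. t - m < snd p})"
        by (intro open_Un open_Int open_Collect_less continuous_intros)+
      show "A \<subseteq> ({p. fst p < x'} \<union> {p. fst p < x} \<inter> {p. snd p < b + k}) \<union>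
         ({p. x + s < fst p} \<union> {p. x' + s < fst p} \<inter> {p. t - m < snd p})"
      proof
        fix p assume "p \<in> A"
        then have "\<not> (x \<le> fst p \<and> fst p \<le> x + s \<and> snd p < b + k)"
          "\<not> (x' \<le> fst p \<and> fst p \<le> x' + s \<and> t - m < snd p)" using bay by blast+
        then show "p \<in> ({p. fst p < x'} \<union> {p. fst p < x} \<inter> {p. snd p < b + k}) \<union>
         ({p. x + s < fst p} \<union> {p. x' + s < fst p} \<inter> {p. t - m < snd p})"
          using tall ov by auto
      qed
    qed (use bay False tall ov assms(1) in auto)
  qed
qed

lemma bays_area:
  assumes "0 \<le> s" "bottom_bay s x k" "top_bay s x' m"
  shows "s * (k + m) \<le> (r - l) * (t - b) - measure lebesgue A"
proof -
  note bay = assms(2,3)[unfolded bottom_bay_def top_bay_def]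
  let ?B = "box (x, b) (x + s, b + k)" and ?T = "box (x', t - m) (x' + s, t)"
  have "s * (k + m) = measure lebesgue ?B + measure lebesgue ?T"
    using bay assms(1) measure_open_rectangle[of x "x + s" b "b + k"]
      measure_open_rectangle[of x' "x' + s" "t - m" t] by (simp add: algebra_simps)
  also have "\<dots> = measure lebesgue (?B \<union> ?T)"
  proof (rule measure_Un2[THEN trans, symmetric])
    have "?T - ?B = ?T"
      using bays_do_not_overlap[OF assms] by (auto simp: box_Pair)
    then show "measure lebesgue ?B + measure lebesgue (?T - ?B)
      = measure lebesgue ?B + measure lebesgue ?T" by simp
  qed auto
  also have "\<dots> \<le> (r - l) * (t - b) - measure lebesgue A"
  proof (rule missing_area)
    show "(?B \<union> ?T) \<inter> A = {}" using bay by (force simp: box_Pair)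
    show "?B \<union> ?T \<subseteq> {l..r} \<times> {b..t}" using bay by (auto simp: box_Pair)
  qed (auto intro: fmeasurable.Un)
  finally show ?thesis .
qed

text \<open>
  Here \<open>s\<close> stands for $2d$. The conditions on \<open>u\<close> ask for $\max(0,
  2h-s+\tau) \leq u \leq \min(2h, s-\beta)$, where $\beta$ and $\tau$ are the suprema of the depths
  of the lower and of the upper bays; the largest such \<open>u\<close> is taken. The interval is
  nonempty because $\beta+\tau \leq \mu/s$ is at most \<open>s\<close> and, by $(s-h)^2 \geq 0$, at
  most $2s-2h$.
\<close>

lemma ex_vertical_offset:
  assumes "0 < s" "0 \<le> h" "s\<^sup>2 = h\<^sup>2 + ((r - l) * (t - b) - measure lebesgue A)" "s \<le> r - l"
  obtains u where "0 \<le> u" "u \<le> 2 * h" "u \<le> s" "2 * h - u \<le> s"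
    "\<And>x k. bottom_bay s x k \<Longrightarrow> k \<le> s - u"
    "\<And>x k. top_bay s x k \<Longrightarrow> k \<le> s - (2 * h - u)"
proof -
  define \<mu> where "\<mu> = (r - l) * (t - b) - measure lebesgue A"
  have flat: "bottom_bay s l 0" "top_bay s l 0"
    using assms box_ordered in_box by (fastforce simp: bottom_bay_def top_bay_def)+
  define K where "K = {k. \<exists>x. bottom_bay s x k}"
  have K: "K \<noteq> {}" "bdd_above K"
    using flat(1) by (auto simp: K_def) (auto simp: bottom_bay_def intro!: bdd_aboveI[of _ "t - b"])
  define \<beta> where "\<beta> = Sup K"
  have le_\<beta>: "k \<le> \<beta>" if "bottom_bay s x k" for x k
    unfolding \<beta>_def using K that by (intro cSup_upper) (auto simp: K_def)
  have joint: "\<beta> + m \<le> \<mu> / s" if "top_bay s x m" for x m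
  proof -
    have "\<beta> \<le> \<mu> / s - m"
      unfolding \<beta>_def
    proof (rule cSup_least[OF K(1)])
      fix k assume "k \<in> K"
      then obtain x' where "bottom_bay s x' k" by (auto simp: K_def)
      from bays_area[OF _ this that] assms(1) have "s * (k + m) \<le> \<mu>" by (simp add: \<mu>_def)
      with assms(1) show "k \<le> \<mu> / s - m" by (simp add: field_simps)
    qed
    then show ?thesis by simp
  qed
  \<comment> \<open>This is \<open>0 \<le> (s - h)\<^sup>2\<close>.\<close>
  have "\<mu> \<le> s * (2 * s - 2 * h)"
    using assms(3) sum_power2_ge_zero[of "s - h" 0] unfolding \<mu>_def by (simp add: power2_eq_square algebra_simps)
  then have \<mu>_le: "\<mu> / s \<le> 2 * s - 2 * h" using assms(1) by (simp add: field_simps)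
  have "\<mu> \<le> s * s" using assms(3) by (simp add: \<mu>_def power2_eq_square)
  then have "\<mu> / s \<le> s" using assms(1) by (simp add: field_simps)
  have \<beta>: "0 \<le> \<beta>" using le_\<beta>[OF flat(1)] .
  have "\<beta> \<le> \<mu> / s" using joint[OF flat(2)] by simp
  show ?thesis
  proof (rule that[of "min (2 * h) (s - \<beta>)"])
    fix x k assume "bottom_bay s x k"
    then show "k \<le> s - min (2 * h) (s - \<beta>)" using le_\<beta> by fastforce
  next
    fix x k assume "top_bay s x k"
    from joint[OF this] \<beta> \<mu>_le \<open>\<mu> / s \<le> s\<close>
    show "k \<le> s - (2 * h - min (2 * h) (s - \<beta>))" by linarith
  qed (use assms(1,2) \<beta> \<mu>_le \<open>\<mu> / s \<le> s\<close> \<open>\<beta> \<le> \<mu> / s\<close> in linarith)+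
qed

text \<open>
  The square of side $2d+2\eta$ around \<open>p\<close> misses \<open>A\<close>. Clipped to the box
  it still is at least $2d$ high, and it is strictly wider than $2d$ because the box is. Its height
  is positive even for $d = 0$, since a box that contains a set of positive area is not flat.
\<close>

lemma missing_square_area:
  assumes "0 < measure lebesgue A" "0 \<le> d" "2 * d < r - l" "0 < \<eta>"
    and "l + d \<le> fst p" "fst p \<le> r - d" "b + d \<le> snd p" "snd p \<le> t - d"
    and far: "\<And>q. q \<in> A \<Longrightarrow> \<not> (\<bar>fst p - fst q\<bar> \<le> d + \<eta> \<and> \<bar>snd p - snd q\<bar> \<le> d + \<eta>)"
  shows "(2 * d)\<^sup>2 < (r - l) * (t - b) - measure lebesgue A"
proof -
  define e where "e = d + \<eta>"
  define x1 x2 y1 y2 where xy: "x1 = max l (fst p - e)" "x2 = min r (fst p + e)"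
    "y1 = max b (snd p - e)" "y2 = min t (snd p + e)"
  have "0 < (r - l) * (t - b)" using assms(1) area_le by linarith
  then have "0 < t - b" using box_ordered by (simp add: zero_less_mult_iff)
  then have dims: "2 * d < x2 - x1" "2 * d \<le> y2 - y1" "0 < y2 - y1"
    using assms(2-8) by (auto simp: xy e_def min_def max_def)
  have "(2 * d)\<^sup>2 \<le> 2 * d * (y2 - y1)"
    unfolding power2_eq_square using dims assms(2) by (intro mult_left_mono) auto
  also have "\<dots> < (x2 - x1) * (y2 - y1)"
    using dims by (intro mult_strict_right_mono)
  also have "\<dots> = measure lebesgue (box (x1, y1) (x2, y2))"
    using dims assms(2) by (intro measure_open_rectangle[symmetric]) auto
  also have "\<dots> \<le> (r - l) * (t - b) - measure lebesgue A"
  proof (rule missing_area)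
    show "box (x1, y1) (x2, y2) \<inter> A = {}"
      using far by (fastforce simp: box_Pair xy e_def)
    show "box (x1, y1) (x2, y2) \<subseteq> {l..r} \<times> {b..t}"
      by (auto simp: box_Pair xy)
  qed simp
  finally show ?thesis .
qed

section \<open>A square close to the set\<close>

lemma near_square_if_wide:
  assumes wide: "t - b \<le> r - l" and pos: "0 < measure lebesgue A" and d: "0 \<le> d"
    and d2: "(2 * d)\<^sup>2 = ((r - l + (t - b)) / 2)\<^sup>2 - measure lebesgue A"
  shows "\<exists>S. is_square S \<and> d_inf A S \<le> d"
proof -
  define w h where "w = r - l" and "h = (r - l - (t - b)) / 2"
  have "0 \<le> h" using wide by (simp add: h_def)
  have v: "t - b = w - 2 * h" by (simp add: h_def w_def field_simps)
  have d2': "(2 * d)\<^sup>2 = h\<^sup>2 + ((r - l) * (t - b) - measure lebesgue A)"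
    unfolding d2 h_def by (simp add: power2_eq_square field_simps)
  \<comment> \<open>The width \<open>w - 2 * d\<close> of the square is positive, since \<open>A\<close> has positive area.\<close>
  have "(2 * d)\<^sup>2 < ((r - l + (t - b)) / 2)\<^sup>2" using d2 pos by simp
  also have "\<dots> \<le> w\<^sup>2" using wide box_ordered by (intro power_mono) (auto simp: w_def)
  finally have small: "2 * d < w"
    by (rule power2_less_imp_less) (use box_ordered in \<open>simp add: w_def\<close>)
  have h0: "h = 0" if "d = 0"
    using d2' that area_le by (auto simp: add_nonneg_eq_0_iff)
  \<comment> \<open>For \<open>d = 0\<close> bays carry no area and their depths are not controlled. But then \<open>h = 0\<close> and \<open>S\<close> is the
     box, so no square of side \<open>2 * d\<close> around a point of \<open>S\<close> protrudes, and no bay has to be excluded.\<close>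
  obtain u where u: "0 \<le> u" "u \<le> 2 * h" "u \<le> 2 * d" "2 * h - u \<le> 2 * d"
    and bot: "0 < d \<Longrightarrow> bottom_bay (2 * d) x k \<Longrightarrow> k \<le> 2 * d - u"
    and top: "0 < d \<Longrightarrow> top_bay (2 * d) x k \<Longrightarrow> k \<le> 2 * d - (2 * h - u)" for x k
  proof (cases "d = 0")
    case True
    then show ?thesis using that[of 0] h0 by simp
  next
    case False
    with d have "0 < 2 * d" by simp
    moreover have "2 * d \<le> r - l" using small by (simp add: w_def)
    ultimately show ?thesis
      using ex_vertical_offset[OF _ \<open>0 \<le> h\<close> d2'] that by metis
  qed
  define S where "S = {l + d..l + d + (w - 2 * d)} \<times> {b + d - u..b + d - u + (w - 2 * d)}"
  have "d_inf A S \<le> d"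
  proof (rule d_inf_le[OF d], intro conjI)
    fix \<eta> :: real assume "\<eta> > 0"
    \<comment> \<open>Nearest points of \<open>S\<close> for the maximum metric are found coordinate by coordinate.\<close>
    define clamp where "clamp c x = max c (min (c + (w - 2 * d)) x)" for c x :: real
    show "A \<subseteq> S + B_inf (d + \<eta>)"
      unfolding subset_plus_B_inf_iff
    proof
      fix p assume "p \<in> A"
      then have p: "l \<le> fst p" "fst p \<le> r" "b \<le> snd p" "snd p \<le> t" using in_box by auto
      show "\<exists>q\<in>S. \<bar>fst p - fst q\<bar> \<le> d + \<eta> \<and> \<bar>snd p - snd q\<bar> \<le> d + \<eta>"
        using p u v small d \<open>\<eta> > 0\<close>
        by (intro bexI[of _ "(clamp (l + d) (fst p), clamp (b + d - u) (snd p))"])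
          (auto simp: S_def clamp_def min_def max_def w_def)
    qed
    show "S \<subseteq> A + B_inf (d + \<eta>)"
      unfolding subset_plus_B_inf_iff
    proof (rule ballI, rule ccontr)
      fix p assume "p \<in> S"
      then have p: "l + d \<le> fst p" "fst p \<le> r - d" "b + d - u \<le> snd p" "snd p \<le> t + 2 * h - d - u"
        using v by (auto simp: S_def w_def)
      assume "\<not> (\<exists>q\<in>A. \<bar>fst p - fst q\<bar> \<le> d + \<eta> \<and> \<bar>snd p - snd q\<bar> \<le> d + \<eta>)"
      then have far: "\<not> (\<bar>fst p - fst q\<bar> \<le> d + \<eta> \<and> \<bar>snd p - snd q\<bar> \<le> d + \<eta>)" if "q \<in> A" for q
        using that by blast
      \<comment> \<open>A square around \<open>p\<close> that protrudes on both sides contains a vertical strip of the box.\<close>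
      have strip: False if "snd p - (d + \<eta>) \<le> b" "t \<le> snd p + (d + \<eta>)"
      proof (rule no_crossing_strip[of "fst p - d" "fst p + d"])
        fix q assume "q \<in> A"
        with far[OF this] in_box that \<open>\<eta> > 0\<close>
        show "\<not> (fst p - d \<le> fst q \<and> fst q \<le> fst p + d)" by fastforce
      qed (use p d in auto)
      consider "snd p < b + d" | "t - d < snd p" | "b + d \<le> snd p" "snd p \<le> t - d" by linarith
      then show False
      proof cases
        case 1
        then have "0 < d" using p u h0 d by (cases "d = 0") auto
        have "snd p + (d + \<eta>) \<le> t" using strip 1 \<open>\<eta> > 0\<close> by (intro leI notI) auto
        have "bottom_bay (2 * d) (fst p - d) (snd p + (d + \<eta>) - b)"
          unfolding bottom_bay_def
        proof (intro conjI ballI)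
          fix q assume "q \<in> A"
          with far[OF this] in_box 1 \<open>\<eta> > 0\<close>
          show "\<not> (fst p - d \<le> fst q \<and> fst q \<le> fst p - d + 2 * d \<and> snd q < b + (snd p + (d + \<eta>) - b))"
            by fastforce
        next
          show "0 \<le> snd p + (d + \<eta>) - b" using p u \<open>\<eta> > 0\<close> by simp
        qed (use p \<open>snd p + (d + \<eta>) \<le> t\<close> in auto)
        from bot[OF \<open>0 < d\<close> this] p \<open>\<eta> > 0\<close> show False by simp
      next
        case 2
        then have "0 < d" using p u h0 d by (cases "d = 0") auto
        have "b \<le> snd p - (d + \<eta>)" using strip 2 \<open>\<eta> > 0\<close> by (intro leI notI) auto
        have "top_bay (2 * d) (fst p - d) (t - (snd p - (d + \<eta>)))"
          unfolding top_bay_def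
        proof (intro conjI ballI)
          fix q assume "q \<in> A"
          with far[OF this] in_box 2 \<open>\<eta> > 0\<close>
          show "\<not> (fst p - d \<le> fst q \<and> fst q \<le> fst p - d + 2 * d \<and> t - (t - (snd p - (d + \<eta>))) < snd q)"
            by fastforce
        next
          show "0 \<le> t - (snd p - (d + \<eta>))" using p u \<open>\<eta> > 0\<close> by simp
        qed (use p \<open>b \<le> snd p - (d + \<eta>)\<close> in auto)
        from top[OF \<open>0 < d\<close> this] p \<open>\<eta> > 0\<close> show False by simp
      next
        case 3
        have "(2 * d)\<^sup>2 < (r - l) * (t - b) - measure lebesgue A"
          using missing_square_area[OF pos d _ \<open>\<eta> > 0\<close> p(1,2) 3 far] small by (simp add: w_def)
        with d2' show False by (smt (verit) zero_le_power2)
      qed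
    qed
  qed
  moreover have "is_square S"
    unfolding is_square_def S_def using small by (metis diff_gt_0_iff_gt)
  ultimately show ?thesis by blast
qed

lemma swapped: "boxed_continuum (prod.swap ` A) b t l r"
proof
  show "compact (prod.swap ` A)" "connected (prod.swap ` A)"
    using compact connected
    by (auto intro!: compact_continuous_image connected_continuous_image continuous_intros)
qed (use in_box touch in force)+

end

lemma measure_lebesgue_swap:
  fixes A :: "plane set"
  assumes "compact A"
  shows "measure lebesgue (prod.swap ` A) = measure lebesgue A"
proof -
  have comp: "compact (prod.swap ` A)"
    using assms by (intro compact_continuous_image continuous_intros)
  have swap_invariant: "(lborel :: plane measure) = distr lborel lborel prod.swap"
    using lborel_pair.distr_pair_swap[where 'a=real and 'b=real]
    by (simp add: lborel_prod case_prod_beta' flip: prod.swap_def)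
  have "measure lborel (prod.swap ` A)
      = measure (distr lborel lborel prod.swap) (prod.swap ` A)"
    by (simp only: swap_invariant[symmetric])
  also have "\<dots> = measure lborel (prod.swap -` prod.swap ` A)"
    using comp by (subst measure_distr)
      (auto simp: borel_compact intro!: borel_measurable_continuous_onI continuous_on_swap)
  also have "prod.swap -` prod.swap ` A = A"
    by (simp add: inj_vimage_image_eq)
  finally show ?thesis
    using assms comp by (simp add: measure_completion borel_compact)
qed

lemma (in boxed_continuum) near_square:
  assumes "0 < measure lebesgue A" "0 \<le> d"
    "(2 * d)\<^sup>2 = ((r - l + (t - b)) / 2)\<^sup>2 - measure lebesgue A"
  shows "\<exists>S. is_square S \<and> d_inf A S \<le> d"
proof (cases "t - b \<le> r - l")
  case True
  with near_square_if_wide assms show ?thesis by blast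
next
  case False
  interpret sw: boxed_continuum "prod.swap ` A" b t l r by (rule swapped)
  obtain S where S: "is_square S" "d_inf (prod.swap ` A) S \<le> d"
    using sw.near_square_if_wide[of d] False assms
    by (auto simp: measure_lebesgue_swap[OF compact] add.commute)
  have "is_square (prod.swap ` S)"
    using S(1) unfolding is_square_def by (metis product_swap)
  moreover have "d_inf A (prod.swap ` S) \<le> d"
    using S(2) d_inf_swap[of A "prod.swap ` S"] by (simp add: image_image)
  ultimately show ?thesis by blast
qed

section \<open>Length of a closed curve and its bounding box\<close>

lemma abs_diff_le_variation:
  fixes f :: "nat \<Rightarrow> real"
  assumes "m \<le> n"
  shows "\<bar>f m - f n\<bar> \<le> (\<Sum>i=m..<n. \<bar>f i - f (Suc i)\<bar>)"
  using assms by (induction n rule: dec_induct) auto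

text \<open>
  A closed sequence has to run from \<open>f i\<close> to \<open>f j\<close> and back.
\<close>

lemma twice_diff_le_closed_variation:
  fixes f :: "nat \<Rightarrow> real"
  assumes "i \<le> n" "j \<le> n" "f 0 = f n"
  shows "2 * \<bar>f i - f j\<bar> \<le> (\<Sum>k<n. \<bar>f k - f (Suc k)\<bar>)"
  using assms(1,2)
proof (induction i j rule: linorder_wlog)
  case (le i j)
  have "2 * \<bar>f i - f j\<bar> \<le> \<bar>f 0 - f i\<bar> + \<bar>f i - f j\<bar> + \<bar>f j - f n\<bar>"
    using abs_triangle_ineq4[of "f 0 - f i" "f n - f j"] assms(3)
    by (simp add: abs_minus_commute)
  also have "\<dots> \<le> (\<Sum>k=0..<i. \<bar>f k - f (Suc k)\<bar>)
      + (\<Sum>k=i..<j. \<bar>f k - f (Suc k)\<bar>) + (\<Sum>k=j..<n. \<bar>f k - f (Suc k)\<bar>)"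
    using le by (intro add_mono abs_diff_le_variation) auto
  also have "\<dots> = (\<Sum>k<n. \<bar>f k - f (Suc k)\<bar>)"
    using le by (simp add: sum.atLeastLessThan_concat lessThan_atLeast0)
  finally show ?case .
qed (simp add: abs_minus_commute)

text \<open>
  The length of an inscribed polygon is the sum of the variations of its two coordinates. So it is
  enough to take one polygon that has all four points among its vertices.
\<close>

lemma L1_length_ge_widths:
  assumes "rectifiable g" "pathfinish g = pathstart g" "{p1, p2, p3, p4} \<subseteq> path_image g"
  shows "2 * \<bar>fst p1 - fst p2\<bar> + 2 * \<bar>snd p3 - snd p4\<bar> \<le> L1_length g"
proof -
  from assms(3) obtain s1 s2 s3 s4 where s: "{s1, s2, s3, s4} \<subseteq> {0..1}"
    "g s1 = p1" "g s2 = p2" "g s3 = p3" "g s4 = p4"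
    by (auto simp: path_image_def)
  define T where "T = {0, 1, s1, s2, s3, s4}"
  define ts where "ts = sorted_list_of_set T"
  define n where "n = length ts - 1"
  have ts: "sorted ts" "set ts = T"
    unfolding ts_def by (auto simp: T_def simp del: sorted_list_of_set_insert_remove)
  then have "ts \<noteq> []" by (auto simp: T_def)
  then have len: "length ts = Suc n" by (simp add: n_def)
  have index: "\<exists>i\<le>n. ts ! i = x" if "x \<in> T" for x
    using that ts(2) len by (metis in_set_conv_nth less_Suc_eq_le)
  have mono: "mono_on {..n} (\<lambda>i. ts ! i)"
    using ts(1) len by (auto intro!: mono_onI sorted_nth_mono)
  have range: "0 \<le> ts ! i" "ts ! i \<le> 1" if "i \<le> n" for i
    using that ts(2) len s(1) nth_mem[of i ts] by (auto simp: T_def)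
  obtain i0 i1 where "i0 \<le> n" "ts ! i0 = 0" "i1 \<le> n" "ts ! i1 = 1"
    using index[of 0] index[of 1] by (auto simp: T_def)
  with mono_onD[OF mono, of 0 i0] mono_onD[OF mono, of i1 n] range[of 0] range[of n]
  have ends: "ts ! 0 = 0" "ts ! n = 1" by simp_all
  have closed: "g (ts ! 0) = g (ts ! n)"
    using assms(2) by (simp add: ends pathfinish_def pathstart_def)
  obtain i1 i2 where i12: "i1 \<le> n" "ts ! i1 = s1" "i2 \<le> n" "ts ! i2 = s2"
    using index[of s1] index[of s2] by (auto simp: T_def)
  have x: "2 * \<bar>fst p1 - fst p2\<bar> \<le> (\<Sum>k<n. \<bar>fst (g (ts ! k)) - fst (g (ts ! Suc k))\<bar>)"
    using twice_diff_le_closed_variation[of i1 n i2 "\<lambda>k. fst (g (ts ! k))"] i12 s closed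
    by simp
  obtain i3 i4 where i34: "i3 \<le> n" "ts ! i3 = s3" "i4 \<le> n" "ts ! i4 = s4"
    using index[of s3] index[of s4] by (auto simp: T_def)
  have y: "2 * \<bar>snd p3 - snd p4\<bar> \<le> (\<Sum>k<n. \<bar>snd (g (ts ! k)) - snd (g (ts ! Suc k))\<bar>)"
    using twice_diff_le_closed_variation[of i3 n i4 "\<lambda>k. snd (g (ts ! k))"] i34 s closed
    by simp
  have "(\<Sum>k<n. L1_dist (g (ts ! k)) (g (ts ! Suc k))) \<le> L1_length g"
    unfolding L1_length_def
  proof (rule cSup_upper)
    show "(\<Sum>k<n. L1_dist (g (ts ! k)) (g (ts ! Suc k))) \<in> inscribed_lengths g"
      unfolding inscribed_lengths_def mem_Collect_eq
      by (intro exI[of _ n] exI[of _ "\<lambda>i. ts ! i"] conjI refl ends mono)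
  qed (use assms(1) in \<open>simp add: rectifiable_def\<close>)
  with x y show ?thesis by (simp add: L1_dist_def sum.distrib)
qed

lemma extreme_point_in_frontier:
  fixes A :: "'a::real_inner set"
  assumes "p \<in> A" "v \<noteq> 0" "\<And>q. q \<in> A \<Longrightarrow> v \<bullet> q \<le> v \<bullet> p"
  shows "p \<in> frontier A"
proof -
  have "p \<notin> interior A"
  proof
    assume "p \<in> interior A"
    then obtain e where e: "e > 0" "cball p e \<subseteq> A" by (auto simp: mem_interior_cball)
    define q where "q = p + (e / norm v) *\<^sub>R v"
    have "q \<in> A" using e assms(2) by (auto simp: q_def dist_norm)
    then have "(e / norm v) * (v \<bullet> v) \<le> 0"
      using assms(3)[of q] by (simp add: q_def inner_add_right)
    moreover have "(e / norm v) * (v \<bullet> v) > 0" using e assms(2) by simp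
    ultimately show False by simp
  qed
  with assms(1) closure_subset show ?thesis by (auto simp: frontier_def)
qed

section \<open>Stability of the isoperimetric inequality\<close>

theorem theorem1p1:
  fixes A :: "plane set" and \<gamma> :: "real \<Rightarrow> plane" and \<epsilon> :: real
  assumes "domain A"
    and "Jordan_curve \<gamma>" and "path_image \<gamma> = frontier A"
    and "rectifiable \<gamma>"
    and "(L1_length \<gamma>)\<^sup>2 \<le> (16 + \<epsilon>) * measure lebesgue A"
  shows "\<exists>S. is_square S \<and> (d_inf A S)\<^sup>2 \<le> \<epsilon> * measure lebesgue A / 64"
proof -
  obtain g C where gC: "Jordan_curve g" "C \<in> components (- path_image g)" "bounded C" "A = closure C"
    using assms(1) by (auto simp: domain_def)
  have "closed (path_image g)"
    using gC(1) by (auto simp: Jordan_curve_def intro: closed_path_image simple_path_imp_path)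
  then have "open C" using gC(2) open_components by blast
  have C: "C \<noteq> {}" "connected C"
    using gC(2) in_components_nonempty in_components_connected by auto
  have comp: "compact A" using gC by simp
  have conn: "connected A" using gC(4) C connected_imp_connected_closure by blast
  have "A \<noteq> {}" using gC(4) C by auto
  have pos: "0 < measure lebesgue A"
  proof -
    have "C \<subseteq> A" by (simp add: gC(4) closure_subset)
    then have "\<not> negligible A"
      using open_not_negligible[OF \<open>open C\<close> C(1)] negligible_subset by blast
    then show ?thesis
      using lmeasurable_compact[OF comp] negligible_iff_measure
      by (metis zero_less_measure_iff)
  qed
  obtain p1 where p1: "p1 \<in> A" "\<And>q. q \<in> A \<Longrightarrow> fst p1 \<le> fst q"
    using continuous_attains_inf[OF comp \<open>A \<noteq> {}\<close>, of fst] continuous_on_fst[OF continuous_on_id]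
    by blast
  obtain p2 where p2: "p2 \<in> A" "\<And>q. q \<in> A \<Longrightarrow> fst q \<le> fst p2"
    using continuous_attains_sup[OF comp \<open>A \<noteq> {}\<close>, of fst] continuous_on_fst[OF continuous_on_id]
    by blast
  obtain p3 where p3: "p3 \<in> A" "\<And>q. q \<in> A \<Longrightarrow> snd p3 \<le> snd q"
    using continuous_attains_inf[OF comp \<open>A \<noteq> {}\<close>, of snd] continuous_on_snd[OF continuous_on_id]
    by blast
  obtain p4 where p4: "p4 \<in> A" "\<And>q. q \<in> A \<Longrightarrow> snd q \<le> snd p4"
    using continuous_attains_sup[OF comp \<open>A \<noteq> {}\<close>, of snd] continuous_on_snd[OF continuous_on_id]
    by blast
  interpret boxed_continuum A "fst p1" "fst p2" "snd p3" "snd p4"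
  proof
    show "\<exists>y. (fst p1, y) \<in> A" "\<exists>y. (fst p2, y) \<in> A" "\<exists>x. (x, snd p3) \<in> A" "\<exists>x. (x, snd p4) \<in> A"
      using p1(1) p2(1) p3(1) p4(1) by (metis prod.collapse)+
  qed (use comp conn p1 p2 p3 p4 in auto)
  have "{p1, p2, p3, p4} \<subseteq> path_image \<gamma>"
    unfolding assms(3)
    using extreme_point_in_frontier[of p1 A "(-1, 0)"] extreme_point_in_frontier[of p2 A "(1, 0)"]
      extreme_point_in_frontier[of p3 A "(0, -1)"] extreme_point_in_frontier[of p4 A "(0, 1)"]
      p1 p2 p3 p4 by (simp add: inner_prod_def zero_prod_def)
  then have length: "2 * (fst p2 - fst p1 + (snd p4 - snd p3)) \<le> L1_length \<gamma>"
    using L1_length_ge_widths[of \<gamma> p1 p2 p3 p4] assms(2,4) p2(2)[OF p1(1)] p4(2)[OF p3(1)]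
    by (simp add: Jordan_curve_def)
  define half where "half = (fst p2 - fst p1 + (snd p4 - snd p3)) / 2"
  define a where "a = measure lebesgue A"
  \<comment> \<open>That the radicand in the definition of \<open>d\<close> is nonnegative follows from the bound by the area of the
     box and the inequality between the arithmetic and the geometric mean.\<close>
  have "a \<le> (fst p2 - fst p1) * (snd p4 - snd p3)" using area_le by (simp add: a_def)
  also have "\<dots> \<le> half\<^sup>2"
    using zero_le_power2[of "fst p2 - fst p1 - (snd p4 - snd p3)"]
    by (simp add: half_def power2_eq_square field_simps)
  finally have "a \<le> half\<^sup>2" .
  define d where "d = sqrt (half\<^sup>2 - a) / 2"
  have d: "0 \<le> d" "(2 * d)\<^sup>2 = half\<^sup>2 - a" using \<open>a \<le> half\<^sup>2\<close> by (simp_all add: d_def)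
  obtain S where S: "is_square S" "d_inf A S \<le> d"
    using near_square[OF pos d(1)] d(2) by (auto simp: half_def a_def)
  have "(4 * half)\<^sup>2 \<le> (L1_length \<gamma>)\<^sup>2"
    using length box_ordered by (intro power_mono) (auto simp: half_def)
  then have "16 * half\<^sup>2 \<le> (16 + \<epsilon>) * a"
    using assms(5) by (simp add: a_def power_mult_distrib)
  then have "d\<^sup>2 \<le> \<epsilon> * a / 64" using d(2) by (simp add: power_mult_distrib algebra_simps)
  moreover have "bounded S" "S \<noteq> {}"
    using S(1) by (auto simp: is_square_def intro!: bounded_Times)
  then have "(d_inf A S)\<^sup>2 \<le> d\<^sup>2"
    using S(2) d_inf_nonneg[of A S] compact_imp_bounded[OF comp] \<open>A \<noteq> {}\<close>
    by (intro power_mono) auto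
  ultimately show ?thesis using S(1) by (auto simp: a_def)
qed

end
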